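(* Consider the load-balancing system described in the context, operated under any load balancing policy belonging to the set $\Pi$, and let $S=(S_{i,m})$ be distributed according to the stationary distribution of the state process. Let $w_u=\max\{(1-p)\mu_1,\mu_2\}$, $w_l=\min\{(1-p)\mu_1,\mu_2\}$, $\mu_{\max}=\max\{\mu_1,\mu_2\}$ and $k=\left(1+\frac{w_u b}{w_l}\right)\left(\frac{1+\mu_1+\mu_2}{w_l}+2\mu_1\right)$. If $N$ satisfies $$\frac{w_lN^{0.5-\alpha}}{1+\mu_1+\mu_2} \geq \log N \geq \frac{3.5}{\min\left(\frac{\mu_1}{16\mu_{\max}},\frac{\mu_2}{12\mu_{\max}},\frac{\mu_1\mu_2}{40\mu_{\max}}\right)},$$ then $$\mathbb E\left[\max\left\{\sum_{i=1}^{b} S_i- \lambda -\frac{k\log N}{\sqrt{N}},0\right\}\right] \leq \frac{7\mu_{\max}}{\sqrt{N}\log N}.$$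
   Context: System: $N$ identical servers. Jobs arrive according to a Poisson process of rate $\lambda N$ with $\lambda=1-N^{-\alpha}$, $0<\alpha<0.5$. Service times are Coxian-2 with parameters $(\mu_1,\mu_2,p)$, $\mu_1,\mu_2>0$, $0\le p<1$: a job in service completes phase 1 at rate $\mu_1$; then with probability $1-p$ it leaves, and with probability $p$ it enters phase 2, which it completes at rate $\mu_2$ and then leaves. It is assumed that $\frac{1}{\mu_1}+\frac{p}{\mu_2}=1$ (unit mean service time). Each server can hold at most $b$ jobs (one in service and $b-1$ in its buffer); a job routed to a server holding $b$ jobs is blocked (discarded). For $t\ge0$, $Q_{j,m}(t)$ ($1\le j\le b$, $m\in\{1,2\}$) is the fraction of servers holding $j$ jobs whose job in service is in phase $m$; $Q_{0,1}(t)$ is the fraction of idle servers and $Q_{0,2}(t)=0$. Let $S_{i,m}(t)=\sum_{j\ge i}Q_{j,m}(t)$ and $S_i(t)=S_{i,1}(t)+S_{i,2}(t)$ (fraction of servers with at least $i$ jobs). The state space is $\mathcal S^{(N)}=\{s\in\mathbb R^{b\times 2}: 1\ge s_{1,m}\ge\cdots\ge s_{b,m}\ge0,\ s_{1,1}+s_{1,2}\le 1,\ Ns_{i,m}\in\mathbb N\ \forall i,m\}$, and $s_i=s_{i,1}+s_{i,2}$. A load balancing policy dispatches each arriving job to a server based on the current state $S(t)$, and is assumed to make the finite-state CTMC $\{S(t)\}$ irreducible, so it has a unique stationary distribution; $S_{i,m}, S_i$ denote the corresponding stationary random variables. For $s\in\mathcal S^{(N)}$, $A_1(s)$ is the probability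 that an arriving job is routed to a busy (non-idle) server when the state is $s$. The policy set $\Pi$ consists of all such policies for which $A_1(s)\le \frac{1}{\sqrt N}$ for every $s\in\mathcal S^{(N)}$ with $s_1\le \lambda+\frac{1+\mu_1+\mu_2}{\min\{(1-p)\mu_1,\mu_2\}}\frac{\log N}{\sqrt N}$. *)

theory Defs
  imports Complex_Main
begin

text \<open>A state s is a function s i m (1 \<le> i \<le> b, m \<in> {1,2}), equal to 0 outside
  this index range; s i m is the fraction of servers with at least i jobs whose job in
  service is in phase m.\<close>

type_synonym lb_state = "nat \<Rightarrow> nat \<Rightarrow> real"

definition state_space :: "nat \<Rightarrow> nat \<Rightarrow> lb_state set" where
  "state_space N b = {s.
     (\<forall>i m. \<not> (1 \<le> i \<and> i \<le> b \<and> (m = 1 \<or> m = 2)) \<longrightarrow> s i m = 0) \<and>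
     (\<forall>m\<in>{1,2}. s 1 m \<le> 1 \<and> (\<forall>i. 1 \<le> i \<and> i < b \<longrightarrow> s (Suc i) m \<le> s i m) \<and> 0 \<le> s b m \<and>
        (\<forall>i. real N * s i m \<in> \<nat>)) \<and>
     s 1 1 + s 1 2 \<le> 1}"

text \<open>Q s j m: fraction of servers with j jobs whose job in service is in phase m;
  Q s 0 1 is the fraction of idle servers and Q s 0 2 = 0.\<close>
definition Qf :: "lb_state \<Rightarrow> nat \<Rightarrow> nat \<Rightarrow> real" where
  "Qf s j m = (if j = 0 then (if m = 1 then 1 - s 1 1 - s 1 2 else 0)
               else s j m - s (Suc j) m)"

definition unit_at :: "nat \<Rightarrow> nat \<Rightarrow> lb_state" where
  "unit_at i m = (\<lambda>i' m'. if i' = i \<and> m' = m then 1 else 0)"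

definition upto_at :: "nat \<Rightarrow> nat \<Rightarrow> lb_state" where
  "upto_at j m = (\<lambda>i' m'. if 1 \<le> i' \<and> i' \<le> j \<and> m' = m then 1 else 0)"

definition shift :: "nat \<Rightarrow> lb_state \<Rightarrow> lb_state \<Rightarrow> lb_state" where
  "shift N s d = (\<lambda>i m. s i m + d i m / real N)"

text \<open>A load balancing policy P: P s j m is the probability that, in state s, an arriving
  job is routed to a server holding j jobs (0 \<le> j \<le> b) whose job in service is in phase m.\<close>
definition valid_policy :: "nat \<Rightarrow> nat \<Rightarrow> (lb_state \<Rightarrow> nat \<Rightarrow> nat \<Rightarrow> real) \<Rightarrow> bool" where
  "valid_policy N b P \<longleftrightarrow> (\<forall>s\<in>state_space N b.
     (\<forall>j m. 0 \<le> P s j m \<and> (0 < P s j m \<longrightarrow> 0 < Qf s j m)) \<and>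
     (\<Sum>j\<in>{0..b}. \<Sum>m\<in>{1,2}. P s j m) = 1)"

text \<open>A_1(s): probability that an arriving job is routed to a busy server.\<close>
definition A1 :: "nat \<Rightarrow> (lb_state \<Rightarrow> nat \<Rightarrow> nat \<Rightarrow> real) \<Rightarrow> lb_state \<Rightarrow> real" where
  "A1 b P s = (\<Sum>j\<in>{1..b}. \<Sum>m\<in>{1,2}. P s j m)"

text \<open>Off-diagonal transition rate from s to s' of the CTMC S(t) (arrival rate lam * N).\<close>
definition rate :: "nat \<Rightarrow> nat \<Rightarrow> real \<Rightarrow> real \<Rightarrow> real \<Rightarrow> real \<Rightarrow>
    (lb_state \<Rightarrow> nat \<Rightarrow> nat \<Rightarrow> real) \<Rightarrow> lb_state \<Rightarrow> lb_state \<Rightarrow> real" where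
  "rate N b lam mu1 mu2 p P s s' =
    (if s' = s then 0 else
      (\<Sum>j\<in>{0..<b}. \<Sum>m\<in>{1,2}.
          if s' = shift N s (unit_at (Suc j) m) then lam * real N * P s j m else 0)
    + (\<Sum>j\<in>{1..b}.
          (if s' = shift N s (\<lambda>i m. upto_at j 2 i m - upto_at j 1 i m)
             then mu1 * p * real N * Qf s j 1 else 0)
        + (if s' = shift N s (\<lambda>i m. - unit_at j 1 i m)
             then mu1 * (1 - p) * real N * Qf s j 1 else 0)
        + (if s' = shift N s (\<lambda>i m. upto_at (j - 1) 1 i m - upto_at j 2 i m)
             then mu2 * real N * Qf s j 2 else 0)))"

definition irreducible_lb :: "nat \<Rightarrow> nat \<Rightarrow> real \<Rightarrow> real \<Rightarrow> real \<Rightarrow> real \<Rightarrow>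
    (lb_state \<Rightarrow> nat \<Rightarrow> nat \<Rightarrow> real) \<Rightarrow> bool" where
  "irreducible_lb N b lam mu1 mu2 p P \<longleftrightarrow>
    (\<forall>s\<in>state_space N b. \<forall>s'\<in>state_space N b.
       (s, s') \<in> {(x, y). x \<in> state_space N b \<and> y \<in> state_space N b \<and>
                          0 < rate N b lam mu1 mu2 p P x y}\<^sup>*)"

definition stationary_dist :: "nat \<Rightarrow> nat \<Rightarrow> real \<Rightarrow> real \<Rightarrow> real \<Rightarrow> real \<Rightarrow>
    (lb_state \<Rightarrow> nat \<Rightarrow> nat \<Rightarrow> real) \<Rightarrow> (lb_state \<Rightarrow> real) \<Rightarrow> bool" where
  "stationary_dist N b lam mu1 mu2 p P \<pi> \<longleftrightarrow>
    (\<forall>s\<in>state_space N b. 0 \<le> \<pi> s) \<and> (\<Sum>s\<in>state_space N b. \<pi> s) = 1 \<and>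
    (\<forall>s\<in>state_space N b.
       \<pi> s * (\<Sum>s'\<in>state_space N b. rate N b lam mu1 mu2 p P s s')
       = (\<Sum>s'\<in>state_space N b. \<pi> s' * rate N b lam mu1 mu2 p P s' s))"

text \<open>The policy class Pi.\<close>
definition in_Pi :: "nat \<Rightarrow> nat \<Rightarrow> real \<Rightarrow> real \<Rightarrow> real \<Rightarrow> real \<Rightarrow>
    (lb_state \<Rightarrow> nat \<Rightarrow> nat \<Rightarrow> real) \<Rightarrow> bool" where
  "in_Pi N b lam mu1 mu2 p P \<longleftrightarrow>
    valid_policy N b P \<and> irreducible_lb N b lam mu1 mu2 p P \<and>
    (\<forall>s\<in>state_space N b.
       s 1 1 + s 1 2 \<le> lam + (1 + mu1 + mu2) / min ((1 - p) * mu1) mu2 * ln (real N) / sqrt (real N)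
       \<longrightarrow> A1 b P s \<le> 1 / sqrt (real N))"

end

theory Submission
  imports Defs
begin

text \<open>Let r be the number of waiting jobs per server and let y, z be the deviations of the
  phase-1 and phase-2 fractions from lam / mu1 and p lam / mu2, so that the total number of jobs
  per server is lam + r + y + z. In the fluid limit \<open>e1 = r + y\<close> relaxes towards r at rate mu1,
  \<open>e2 = e1 + z / p\<close> relaxes towards e1 at rate mu2, and the busy fraction is
  \<open>lam + ((1 - p) e1 + p e2) - r\<close>. The policy lets r grow only while this exceeds
  \<open>lam + h\<close>, i.e. while e1 or e2 is well above r; otherwise r decreases. Hence max (r, e1, e2) is
  a Lyapunov function. Replacing the maximum by a sum of exponentials with rate 2 sqrt N, suitably
  shifted, makes the generator easy to compute, since it is linear, and gives
  \<open>gen Psi + Psi \<le> const\<close>. Stationarity then bounds the mean of Psi, and the excess in the theorem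
  is dominated pointwise by a multiple of Psi smaller by a power of N.\<close>

section \<open>Lattice gaps and quadratic bounds for the exponential\<close>

text \<open>Both points lie on the lattice of multiples of 1/N. This turns a positive
  \<open>Qf\<close> into at least one whole server, which a transition can then move.\<close>

lemma add_inverse_le_of_less:
  fixes x y :: real
  assumes "0 < N" "real N * x \<in> \<int>" "real N * y \<in> \<int>" "x < y"
  shows "x + 1 / real N \<le> y"
proof -
  obtain i j where ij: "real N * x = of_int i" "real N * y = of_int j"
    using assms(2,3) by (auto elim!: Ints_cases)
  have "real N * x < real N * y" using assms by simp
  then have "i + 1 \<le> j" using ij by simp
  then have "real N * x + 1 \<le> real N * y" unfolding ij
    by (metis of_int_1 of_int_add of_int_le_iff)
  then show ?thesis using assms(1) by (simp add: field_simps)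
qed

lemma exp_minus_one_le_quadratic:
  fixes u :: real
  assumes "0 \<le> u" "u \<le> 1"
  shows "exp u - 1 \<le> u + u\<^sup>2"
  using exp_bound[OF assms] by simp

text \<open>The product of 1 - u + u^2/2 and 1 + u + u^2/2 is 1 + u^4/4, hence at least 1, and the
  second factor is at most exp u. So the first factor bounds exp (-u) from above.\<close>

lemma one_minus_exp_minus_ge:
  fixes u :: real
  assumes "0 \<le> u"
  shows "u - u\<^sup>2 / 2 \<le> 1 - exp (- u)"
proof -
  have "1 + u + u\<^sup>2 / 2 \<le> exp u"
    using exp_lower_Taylor_quadratic[OF assms] by simp
  moreover have "1 \<le> (1 - u + u\<^sup>2 / 2) * (1 + u + u\<^sup>2 / 2)"
  proof -
    have "(1 - u + u\<^sup>2 / 2) * (1 + u + u\<^sup>2 / 2) = 1 + (u\<^sup>2)\<^sup>2 / 4"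
      by (simp add: algebra_simps power2_eq_square)
    then show ?thesis by simp
  qed
  moreover have "0 \<le> 1 - u + u\<^sup>2 / 2"
    using sum_squares_ge_zero[of "1 - u" 1] by (simp add: power2_eq_square algebra_simps)
  ultimately have "1 \<le> (1 - u + u\<^sup>2 / 2) * exp u"
    by (meson mult_left_mono order_trans)
  then have "exp (- u) \<le> (1 - u + u\<^sup>2 / 2)"
    by (simp add: exp_minus field_simps)
  then show ?thesis by simp
qed

section \<open>Monotonicity in the state space, and moves that stay inside it\<close>

lemma state_space_nonneg:
  assumes "0 < N" "s \<in> state_space N b"
  shows "0 \<le> s i m"
proof (cases "m \<in> {1, 2}")
  case True
  then have "real N * s i m \<in> \<nat>" using assms(2) by (auto simp: state_space_def)
  then have "0 \<le> real N * s i m" by (auto elim: Nats_cases)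
  then show ?thesis using assms(1) by (simp add: zero_le_mult_iff)
next
  case False
  then have "\<not> (1 \<le> i \<and> i \<le> b \<and> (m = 1 \<or> m = 2))" by auto
  then show ?thesis using assms(2) unfolding state_space_def by (smt (verit) mem_Collect_eq)
qed

lemma state_space_outside:
  assumes "s \<in> state_space N b" "\<not> (1 \<le> i \<and> i \<le> b \<and> (m = 1 \<or> m = 2))"
  shows "s i m = 0"
  using assms unfolding state_space_def by blast

lemma state_space_Suc_le:
  assumes "0 < N" "s \<in> state_space N b" "1 \<le> i" "m \<in> {1, 2}"
  shows "s (Suc i) m \<le> s i m"
proof (cases "i < b")
  case True
  then show ?thesis using assms unfolding state_space_def by blast
next
  case False
  then have "s (Suc i) m = 0" by (intro state_space_outside[OF assms(2)]) auto
  then show ?thesis using state_space_nonneg[OF assms(1,2)] by simp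
qed

lemma state_space_antimono:
  assumes "0 < N" "s \<in> state_space N b" "1 \<le> i" "i \<le> j" "m \<in> {1, 2}"
  shows "s j m \<le> s i m"
  using assms(4) by (induction j rule: dec_induct)
    (use state_space_Suc_le[OF assms(1,2) _ assms(5)] assms(3) order_trans in \<open>force+\<close>)

text \<open>Here \<open>d\<close> is measured in whole servers. The drop from level i to level i + 1
  may shrink by one only if some server holds exactly i jobs in that phase (\<open>dec\<close>), and
  the busy fraction may grow only if some server is idle (\<open>tot\<close>). All four kinds of
  transition are checked against these two conditions.\<close>

lemma shift_in_state_space:
  assumes N: "0 < N" and b: "1 \<le> b" and s: "s \<in> state_space N b"
    and int: "\<And>i m. d i m \<in> \<int>"
    and out: "\<And>i m. \<not> (1 \<le> i \<and> i \<le> b \<and> (m = 1 \<or> m = 2)) \<Longrightarrow> d i m = 0"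
    and dec: "\<And>i m. 1 \<le> i \<Longrightarrow> i \<le> b \<Longrightarrow> m \<in> {1, 2} \<Longrightarrow>
      d (Suc i) m \<le> d i m \<or> 0 < Qf s i m \<and> d (Suc i) m \<le> d i m + 1"
    and tot: "d 1 1 + d 1 2 \<le> 0 \<or> 0 < Qf s 0 1 \<and> d 1 1 + d 1 2 \<le> 1"
  shows "shift N s d \<in> state_space N b"
proof -
  let ?s = "shift N s d"
  have sint: "real N * s i m \<in> \<int>" if "m \<in> {1, 2}" for i m
    using s that Nats_subset_Ints unfolding state_space_def by blast
  have zero: "?s i m = 0" if "\<not> (1 \<le> i \<and> i \<le> b \<and> (m = 1 \<or> m = 2))" for i m
    using out[OF that] state_space_outside[OF s that] by (simp add: shift_def)
  have anti: "?s (Suc i) m \<le> ?s i m" if i: "1 \<le> i" "i \<le> b" and m: "m \<in> {1, 2}" for i m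
    using dec[OF i m]
  proof
    assume "d (Suc i) m \<le> d i m"
    then show ?thesis using state_space_Suc_le[OF N s i(1) m]
      by (simp add: shift_def add_mono divide_right_mono)
  next
    assume a: "0 < Qf s i m \<and> d (Suc i) m \<le> d i m + 1"
    then have "s (Suc i) m < s i m" using i by (auto simp: Qf_def)
    then have 1: "s (Suc i) m + 1 / real N \<le> s i m"
      by (intro add_inverse_le_of_less N sint m)
    have "d (Suc i) m / real N \<le> (d i m + 1) / real N"
      using a by (intro divide_right_mono) auto
    then show ?thesis using 1 by (simp add: shift_def add_divide_distrib)
  qed
  \<comment> \<open>Downward induction from level \<open>Suc b\<close>, where the state vanishes;
    \<open>anti\<close> carries the sign to lower levels.\<close>
  have pos1: "0 \<le> ?s i m" if "m \<in> {1, 2}" "i \<le> Suc b" "1 \<le> i" for i m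
    using that(2,3)
  proof (induction i rule: inc_induct)
    case base
    then show ?case using zero[of "Suc b" m] by simp
  next
    case (step i)
    then show ?case using anti[of i m] that(1) by force
  qed
  have pos: "0 \<le> ?s i m" if "m \<in> {1, 2}" for i m
    using pos1[OF that, of i] zero[of i m] by force
  have nat: "real N * ?s i m \<in> \<nat>" if "m \<in> {1, 2}" for i m
  proof -
    have "real N * ?s i m = real N * s i m + d i m"
      using N by (simp add: shift_def distrib_left)
    then have "real N * ?s i m \<in> \<int>" using sint[OF that, of i] int[of i m] by simp
    moreover have "0 \<le> real N * ?s i m" using pos[OF that, of i] by simp
    ultimately show ?thesis by (simp add: Nats_altdef2)
  qed
  have s1: "?s 1 1 + ?s 1 2 = s 1 1 + s 1 2 + (d 1 1 + d 1 2) / real N"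
    by (simp add: shift_def add_divide_distrib)
  have total: "?s 1 1 + ?s 1 2 \<le> 1"
    using tot
  proof
    assume "d 1 1 + d 1 2 \<le> 0"
    then have "(d 1 1 + d 1 2) / real N \<le> 0" by (simp add: divide_nonpos_nonneg)
    moreover have "s 1 1 + s 1 2 \<le> 1" using s by (simp add: state_space_def)
    ultimately show ?thesis using s1 by simp
  next
    assume a: "0 < Qf s 0 1 \<and> d 1 1 + d 1 2 \<le> 1"
    have "s 1 1 + s 1 2 + 1 / real N \<le> 1"
      using a sint[of 1 1] sint[of 2 1]
      by (intro add_inverse_le_of_less N) (auto simp: Qf_def distrib_left)
    moreover have "(d 1 1 + d 1 2) / real N \<le> 1 / real N"
      using a by (intro divide_right_mono) auto
    ultimately show ?thesis using s1 by simp
  qed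
  have "?s 1 m \<le> 1" if "m \<in> {1, 2}" for m
    using that total pos[of 1 1] pos[of 2 1] by auto
  then show ?thesis
    using zero anti pos nat total unfolding state_space_def by auto
qed

section \<open>Stationary averages and job counts\<close>

text \<open>Swapping the sums weights \<open>f s\<close> by the total inflow into s minus the total
  outflow from s, and global balance makes these equal. This converts a pointwise drift inequality
  into a bound on a stationary mean.\<close>

lemma sum_stationary_generator:
  fixes \<pi> :: "'s \<Rightarrow> real" and q :: "'s \<Rightarrow> 's \<Rightarrow> real"
  assumes "\<And>s. s \<in> S \<Longrightarrow> \<pi> s * (\<Sum>s'\<in>S. q s s') = (\<Sum>s'\<in>S. \<pi> s' * q s' s)"
  shows "(\<Sum>s\<in>S. \<pi> s * (\<Sum>s'\<in>S. q s s' * (f s' - f s))) = 0"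
proof -
  have "(\<Sum>s\<in>S. \<pi> s * (\<Sum>s'\<in>S. q s s' * (f s' - f s)))
      = (\<Sum>s\<in>S. \<Sum>s'\<in>S. \<pi> s * q s s' * f s') - (\<Sum>s\<in>S. (\<pi> s * (\<Sum>s'\<in>S. q s s')) * f s)"
    by (simp add: sum_distrib_left sum_distrib_right sum_subtractf right_diff_distrib mult.assoc)
  also have "(\<Sum>s\<in>S. \<Sum>s'\<in>S. \<pi> s * q s s' * f s') = (\<Sum>s\<in>S. (\<Sum>s'\<in>S. \<pi> s' * q s' s) * f s)"
    by (subst sum.swap) (simp add: sum_distrib_right)
  also have "\<dots> = (\<Sum>s\<in>S. (\<pi> s * (\<Sum>s'\<in>S. q s s')) * f s)"
    using assms by (intro sum.cong) auto
  finally show ?thesis by simp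
qed

definition jobs :: "nat \<Rightarrow> lb_state \<Rightarrow> real" where
  "jobs b s = (\<Sum>i\<in>{1..b}. s i 1 + s i 2)"

lemma jobs_shift: "jobs b (shift N s d) = jobs b s + jobs b d / real N"
  by (simp add: jobs_def shift_def sum.distrib sum_divide_distrib add_divide_distrib)

lemma sum_upto_at: "(\<Sum>i\<in>{1..b}. upto_at j m i m') = (if m' = m then real (min j b) else 0)"
proof (cases "m' = m")
  case True
  have "(\<Sum>i\<in>{1..b}. upto_at j m i m') = (\<Sum>i\<in>{1..b}. if i \<in> {1..j} then 1 else 0)"
    using True by (intro sum.cong) (auto simp: upto_at_def)
  also have "\<dots> = real (card ({1..b} \<inter> {1..j}))"
    by (subst sum.inter_restrict[symmetric]) auto
  also have "{1..b} \<inter> {1..j} = {1..min j b}" by auto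
  finally show ?thesis using True by simp
qed (simp add: upto_at_def)

lemma sum_unit_at: "(\<Sum>i\<in>{1..b}. unit_at j m i m') = (if m' = m \<and> j \<in> {1..b} then 1 else 0)"
proof -
  have "(\<Sum>i\<in>{1..b}. unit_at j m i m') = (\<Sum>i\<in>{1..b}. if i = j then (if m' = m then 1 else 0) else 0)"
    by (intro sum.cong) (auto simp: unit_at_def)
  then show ?thesis by simp
qed

section \<open>The generator and its action on exponentials of linear functions\<close>

locale coxian_lb =
  fixes N b :: nat and lam mu1 mu2 p :: real and P :: "lb_state \<Rightarrow> nat \<Rightarrow> nat \<Rightarrow> real"
  assumes N_pos: "0 < N" and b_pos: "1 \<le> b" and policy: "valid_policy N b P"
    and finite_states: "finite (state_space N b)"
begin

abbreviation "S \<equiv> state_space N b"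

definition gen :: "(lb_state \<Rightarrow> real) \<Rightarrow> lb_state \<Rightarrow> real" where
  "gen f s = (\<Sum>s'\<in>S. rate N b lam mu1 mu2 p P s s' * (f s' - f s))"

lemma policy_nonneg: "s \<in> S \<Longrightarrow> 0 \<le> P s j m"
  and policy_pos_imp: "s \<in> S \<Longrightarrow> P s j m \<noteq> 0 \<Longrightarrow> 0 < Qf s j m"
  and policy_sum: "s \<in> S \<Longrightarrow> (\<Sum>j\<in>{0..b}. \<Sum>m\<in>{1,2}. P s j m) = 1"
  using policy unfolding valid_policy_def by (blast, metis order_le_less, blast)

lemma Qf_nonneg:
  assumes "s \<in> S" "1 \<le> j" "m \<in> {1, 2}"
  shows "0 \<le> Qf s j m"
  using state_space_Suc_le[OF N_pos assms] assms by (auto simp: Qf_def)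

lemma arrival_in:
  assumes s: "s \<in> S" and j: "j < b" and m: "m \<in> {1, 2}" and P: "P s j m \<noteq> 0"
  shows "shift N s (unit_at (Suc j) m) \<in> S"
proof (rule shift_in_state_space[OF N_pos b_pos s])
  have Q: "0 < Qf s j m" using policy_pos_imp[OF s P] .
  \<comment> \<open>Idle servers are labelled phase 1 by convention, so a job joining one starts in
    phase 1.\<close>
  then have m1: "m = 1" if "j = 0" using that by (auto simp: Qf_def split: if_splits)
  show "unit_at (Suc j) m i m' \<in> \<int>" for i m' by (simp add: unit_at_def)
  show "unit_at (Suc j) m i m' = 0" if "\<not> (1 \<le> i \<and> i \<le> b \<and> (m' = 1 \<or> m' = 2))" for i m'
    using that j m by (auto simp: unit_at_def)
  show "unit_at (Suc j) m (Suc i) m' \<le> unit_at (Suc j) m i m' \<or>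
      0 < Qf s i m' \<and> unit_at (Suc j) m (Suc i) m' \<le> unit_at (Suc j) m i m' + 1"
    if "1 \<le> i" "i \<le> b" "m' \<in> {1, 2}" for i m'
    using Q by (auto simp: unit_at_def)
  show "unit_at (Suc j) m 1 1 + unit_at (Suc j) m 1 2 \<le> 0 \<or>
      0 < Qf s 0 1 \<and> unit_at (Suc j) m 1 1 + unit_at (Suc j) m 1 2 \<le> 1"
    using Q m1 by (cases "j = 0") (auto simp: unit_at_def)
qed

lemma phase_change_in:
  assumes s: "s \<in> S" and j: "1 \<le> j" "j \<le> b" and Q: "0 < Qf s j 1"
  shows "shift N s (\<lambda>i m. upto_at j 2 i m - upto_at j 1 i m) \<in> S"
  by (rule shift_in_state_space[OF N_pos b_pos s]) (use j Q in \<open>auto simp: upto_at_def le_Suc_eq Suc_le_eq split: if_splits\<close>)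

lemma completion1_in:
  assumes s: "s \<in> S" and j: "1 \<le> j" "j \<le> b" and Q: "0 < Qf s j 1"
  shows "shift N s (\<lambda>i m. - unit_at j 1 i m) \<in> S"
  by (rule shift_in_state_space[OF N_pos b_pos s]) (use j Q in \<open>auto simp: unit_at_def\<close>)

lemma completion2_in:
  assumes s: "s \<in> S" and j: "1 \<le> j" "j \<le> b" and Q: "0 < Qf s j 2"
  shows "shift N s (\<lambda>i m. upto_at (j - 1) 1 i m - upto_at j 2 i m) \<in> S"
  by (rule shift_in_state_space[OF N_pos b_pos s])
    (use j Q in \<open>auto simp: upto_at_def not_less_eq_eq dest: le_antisym split: if_splits\<close>)

text \<open>\<open>rate\<close> is indexed by target state; interchanging the sums gives one term
  per event. Each event with nonzero rate has its target in \<open>S\<close>, so no term is lost,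
  and events sharing a target simply add up.\<close>

lemma gen_eq:
  assumes s: "s \<in> S"
  shows "gen f s =
    (\<Sum>j\<in>{0..<b}. \<Sum>m\<in>{1,2}. lam * real N * P s j m * (f (shift N s (unit_at (Suc j) m)) - f s))
    + (\<Sum>j\<in>{1..b}.
        mu1 * p * real N * Qf s j 1 * (f (shift N s (\<lambda>i m. upto_at j 2 i m - upto_at j 1 i m)) - f s)
      + mu1 * (1 - p) * real N * Qf s j 1 * (f (shift N s (\<lambda>i m. - unit_at j 1 i m)) - f s)
      + mu2 * real N * Qf s j 2 * (f (shift N s (\<lambda>i m. upto_at (j - 1) 1 i m - upto_at j 2 i m)) - f s))"
proof -
  have one: "(\<Sum>s'\<in>S. (if s' = T then \<rho> else 0) * (f s' - f s)) = \<rho> * (f T - f s)"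
    if "\<rho> \<noteq> 0 \<Longrightarrow> T \<in> S" for T \<rho>
  proof -
    have "(\<Sum>s'\<in>S. (if s' = T then \<rho> else 0) * (f s' - f s))
        = (\<Sum>s'\<in>S. if s' = T then \<rho> * (f T - f s) else 0)"
      by (intro sum.cong) auto
    also have "\<dots> = (if T \<in> S then \<rho> * (f T - f s) else 0)"
      using finite_states by (subst sum.delta) auto
    finally show ?thesis using that by auto
  qed
  have Qpos: "0 < Qf s j m" if "Qf s j m \<noteq> 0" "j \<in> {1..b}" "m \<in> {1, 2}" for j m
    using Qf_nonneg[OF s, of j m] that by force
  have "gen f s = (\<Sum>s'\<in>S.
      ((\<Sum>j\<in>{0..<b}. \<Sum>m\<in>{1,2}.
          if s' = shift N s (unit_at (Suc j) m) then lam * real N * P s j m else 0)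
    + (\<Sum>j\<in>{1..b}.
          (if s' = shift N s (\<lambda>i m. upto_at j 2 i m - upto_at j 1 i m)
             then mu1 * p * real N * Qf s j 1 else 0)
        + (if s' = shift N s (\<lambda>i m. - unit_at j 1 i m)
             then mu1 * (1 - p) * real N * Qf s j 1 else 0)
        + (if s' = shift N s (\<lambda>i m. upto_at (j - 1) 1 i m - upto_at j 2 i m)
             then mu2 * real N * Qf s j 2 else 0))) * (f s' - f s))"
    \<comment> \<open>At \<open>s' = s\<close> both summands are 0, because
      \<open>f s' - f s\<close> vanishes.\<close>
    unfolding gen_def by (intro sum.cong) (auto simp: rate_def)
  also have "\<dots> = (\<Sum>j\<in>{0..<b}. \<Sum>m\<in>{1,2}. \<Sum>s'\<in>S.
          (if s' = shift N s (unit_at (Suc j) m) then lam * real N * P s j m else 0) * (f s' - f s))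
    + (\<Sum>j\<in>{1..b}.
        (\<Sum>s'\<in>S. (if s' = shift N s (\<lambda>i m. upto_at j 2 i m - upto_at j 1 i m)
             then mu1 * p * real N * Qf s j 1 else 0) * (f s' - f s))
        + (\<Sum>s'\<in>S. (if s' = shift N s (\<lambda>i m. - unit_at j 1 i m)
             then mu1 * (1 - p) * real N * Qf s j 1 else 0) * (f s' - f s))
        + (\<Sum>s'\<in>S. (if s' = shift N s (\<lambda>i m. upto_at (j - 1) 1 i m - upto_at j 2 i m)
             then mu2 * real N * Qf s j 2 else 0) * (f s' - f s)))"
    unfolding distrib_right sum.distrib sum_distrib_right
    by (intro arg_cong2[where f = "(+)"] sum.swap)
      (subst sum.swap, intro sum.cong refl sum.swap)
  also have "\<dots> = (\<Sum>j\<in>{0..<b}. \<Sum>m\<in>{1,2}. lam * real N * P s j m * (f (shift N s (unit_at (Suc j) m)) - f s))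
    + (\<Sum>j\<in>{1..b}.
        mu1 * p * real N * Qf s j 1 * (f (shift N s (\<lambda>i m. upto_at j 2 i m - upto_at j 1 i m)) - f s)
      + mu1 * (1 - p) * real N * Qf s j 1 * (f (shift N s (\<lambda>i m. - unit_at j 1 i m)) - f s)
      + mu2 * real N * Qf s j 2 * (f (shift N s (\<lambda>i m. upto_at (j - 1) 1 i m - upto_at j 2 i m)) - f s))"
  proof (intro arg_cong2[where f = "(+)"] sum.cong refl one)
    fix j m assume "j \<in> {0..<b}" "m \<in> {1, 2::nat}" "lam * real N * P s j m \<noteq> 0"
    then show "shift N s (unit_at (Suc j) m) \<in> S" using arrival_in[OF s, of j m] by auto
  next
    fix j assume j: "j \<in> {1..b}"
    show "shift N s (\<lambda>i m. upto_at j 2 i m - upto_at j 1 i m) \<in> S"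
      if "mu1 * p * real N * Qf s j 1 \<noteq> 0"
      using phase_change_in[OF s, of j] Qpos[of j 1] j that by auto
    show "shift N s (\<lambda>i m. - unit_at j 1 i m) \<in> S"
      if "mu1 * (1 - p) * real N * Qf s j 1 \<noteq> 0"
      using completion1_in[OF s, of j] Qpos[of j 1] j that by auto
    show "shift N s (\<lambda>i m. upto_at (j - 1) 1 i m - upto_at j 2 i m) \<in> S"
      if "mu2 * real N * Qf s j 2 \<noteq> 0"
      using completion2_in[OF s, of j] Qpos[of j 2] j that by auto
  qed
  finally show ?thesis .
qed

definition expf :: "real \<Rightarrow> real \<Rightarrow> real \<Rightarrow> real \<Rightarrow> lb_state \<Rightarrow> real" where
  "expf \<theta> x y z s = exp (\<theta> * (x * jobs b s + y * s 1 1 + z * s 1 2))"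

lemma expf_shift:
  "expf \<theta> x y z (shift N s d) - expf \<theta> x y z s
    = expf \<theta> x y z s * (exp (\<theta> / real N * (x * jobs b d + y * d 1 1 + z * d 1 2)) - 1)"
proof -
  have "\<theta> * (x * jobs b (shift N s d) + y * shift N s d 1 1 + z * shift N s d 1 2)
      = \<theta> * (x * jobs b s + y * s 1 1 + z * s 1 2)
        + \<theta> / real N * (x * jobs b d + y * d 1 1 + z * d 1 2)"
    by (simp only: jobs_shift) (simp add: shift_def algebra_simps add_divide_distrib)
  then show ?thesis by (simp add: expf_def exp_add algebra_simps)
qed

lemma jobs_arrival: "j < b \<Longrightarrow> m \<in> {1, 2} \<Longrightarrow> jobs b (unit_at (Suc j) m) = 1"
  unfolding jobs_def sum.distrib sum_unit_at by auto

lemma jobs_phase_change: "jobs b (\<lambda>i m. upto_at j 2 i m - upto_at j 1 i m) = 0"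
  unfolding jobs_def sum.distrib sum_subtractf sum_upto_at by simp

lemma jobs_completion1: "1 \<le> j \<Longrightarrow> j \<le> b \<Longrightarrow> jobs b (\<lambda>i m. - unit_at j 1 i m) = - 1"
  unfolding jobs_def sum.distrib sum_negf sum_unit_at by simp

lemma jobs_completion2:
  "1 \<le> j \<Longrightarrow> j \<le> b \<Longrightarrow> jobs b (\<lambda>i m. upto_at (j - 1) 1 i m - upto_at j 2 i m) = - 1"
  unfolding jobs_def sum.distrib sum_subtractf sum_upto_at by (simp add: of_nat_diff)

text \<open>A jump multiplies the exponential by a factor that depends only on the kind of event and
  on whether the server is idle, holds one job, or holds more: with more than one job, a departure
  starts the next job in phase 1. The sums over queue lengths therefore collapse to levels 1 and 2
  of the state.\<close>

lemma gen_expf: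
  assumes s: "s \<in> S" and t: "t = \<theta> / real N"
  shows "gen (expf \<theta> x y z) s = real N * expf \<theta> x y z s *
    (lam * P s 0 1 * (exp (t * (x + y)) - 1)
     + lam * (\<Sum>j\<in>{1..<b}. \<Sum>m\<in>{1,2}. P s j m) * (exp (t * x) - 1)
     + mu1 * p * s 1 1 * (exp (t * (z - y)) - 1)
     + mu1 * (1 - p) * ((s 1 1 - s 2 1) * (exp (- t * (x + y)) - 1) + s 2 1 * (exp (- t * x) - 1))
     + mu2 * ((s 1 2 - s 2 2) * (exp (- t * (x + z)) - 1) + s 2 2 * (exp (t * (y - x - z)) - 1)))"
proof -
  define F where "F = expf \<theta> x y z s"
  have P02: "P s 0 2 = 0"
    using policy_pos_imp[OF s, of 0 2] by (auto simp: Qf_def)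
  have "(\<Sum>j\<in>{0..<b}. \<Sum>m\<in>{1,2}. lam * real N * P s j m *
          (expf \<theta> x y z (shift N s (unit_at (Suc j) m)) - expf \<theta> x y z s))
      = (\<Sum>j\<in>{0..<b}. \<Sum>m\<in>{1,2}. real N * F * lam *
          (P s j m * (exp (t * (x + (if j = 0 then y else 0))) - 1)))"
    unfolding expf_shift unfolding F_def[symmetric] t
  proof (intro sum.cong refl)
    fix j m assume jm: "j \<in> {0..<b}" "m \<in> {1, 2::nat}"
    show "lam * real N * P s j m * (F * (exp (\<theta> / real N * (x * jobs b (unit_at (Suc j) m)
          + y * unit_at (Suc j) m 1 1 + z * unit_at (Suc j) m 1 2)) - 1))
        = real N * F * lam * (P s j m * (exp (\<theta> / real N * (x + (if j = 0 then y else 0))) - 1))"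
      using jm jobs_arrival[of j m] P02 by (cases "j = 0") (auto simp: unit_at_def)
  qed
  also have "\<dots> = real N * F * lam * (\<Sum>j\<in>{0..<b}. \<Sum>m\<in>{1,2}.
      P s j m * (exp (t * (x + (if j = 0 then y else 0))) - 1))"
    by (simp only: sum_distrib_left)
  also have "(\<Sum>j\<in>{0..<b}. \<Sum>m\<in>{1,2}. P s j m * (exp (t * (x + (if j = 0 then y else 0))) - 1))
      = P s 0 1 * (exp (t * (x + y)) - 1)
        + (\<Sum>j\<in>{1..<b}. \<Sum>m\<in>{1,2}. P s j m) * (exp (t * x) - 1)"
  proof -
    have "{0..<b} = insert 0 {1..<b}" using b_pos by auto
    then show ?thesis by (simp add: P02 sum_distrib_right distrib_right)
  qed
  finally have A: "(\<Sum>j\<in>{0..<b}. \<Sum>m\<in>{1,2}. lam * real N * P s j m *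
          (expf \<theta> x y z (shift N s (unit_at (Suc j) m)) - expf \<theta> x y z s))
      = real N * F * lam * (P s 0 1 * (exp (t * (x + y)) - 1)
        + (\<Sum>j\<in>{1..<b}. \<Sum>m\<in>{1,2}. P s j m) * (exp (t * x) - 1))" .
  \<comment> \<open>Telescoping; the term left over at \<open>Suc b\<close> is 0.\<close>
  have tele: "(\<Sum>j\<in>{1..b}. Qf s j m * (if j = 1 then u else v))
      = (s 1 m - s 2 m) * u + s 2 m * v" if "m \<in> {1, 2}" for u v m
  proof -
    have "(\<Sum>j\<in>{1..b}. Qf s j m * (if j = 1 then u else v))
      = (s 1 m - s 2 m) * u + (s 2 m - s (Suc b) m) * v"
      using b_pos by (induction b rule: nat_induct_at_least)
        (auto simp: Qf_def algebra_simps numeral_2_eq_2)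
    then show ?thesis using state_space_outside[OF s, of "Suc b" m] by simp
  qed
  have B: "(\<Sum>j\<in>{1..b}.
        mu1 * p * real N * Qf s j 1 * (F * (exp (t * (x * jobs b (\<lambda>i m. upto_at j 2 i m - upto_at j 1 i m)
          + y * (upto_at j 2 1 1 - upto_at j 1 1 1) + z * (upto_at j 2 1 2 - upto_at j 1 1 2))) - 1))
      + mu1 * (1 - p) * real N * Qf s j 1 * (F * (exp (t * (x * jobs b (\<lambda>i m. - unit_at j 1 i m)
          + y * - unit_at j 1 1 1 + z * - unit_at j 1 1 2)) - 1))
      + mu2 * real N * Qf s j 2 * (F * (exp (t * (x * jobs b (\<lambda>i m. upto_at (j - 1) 1 i m - upto_at j 2 i m)
          + y * (upto_at (j - 1) 1 1 1 - upto_at j 2 1 1)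
          + z * (upto_at (j - 1) 1 1 2 - upto_at j 2 1 2))) - 1)))
    = (\<Sum>j\<in>{1..b}.
        real N * F * mu1 * p * (exp (t * (z - y)) - 1) * (Qf s j 1 * (if j = 1 then 1 else 1))
      + real N * F * mu1 * (1 - p)
          * (Qf s j 1 * (if j = 1 then exp (- t * (x + y)) - 1 else exp (- t * x) - 1))
      + real N * F * mu2
          * (Qf s j 2 * (if j = 1 then exp (- t * (x + z)) - 1 else exp (t * (y - x - z)) - 1)))"
    (is "sum ?lhs _ = sum ?rhs _")
  proof (intro sum.cong refl)
    fix j assume "j \<in> {1..b}"
    then have j: "1 \<le> j" "j \<le> b" by auto
    show "?lhs j = ?rhs j"
      unfolding jobs_phase_change jobs_completion1[OF j] jobs_completion2[OF j]
      using j by (cases "j = 1") (auto simp: upto_at_def unit_at_def algebra_simps)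
  qed
  show ?thesis
    unfolding gen_eq[OF s] A
    unfolding expf_shift
    unfolding F_def[symmetric] t[symmetric]
    unfolding B
    unfolding sum.distrib
    unfolding sum_distrib_left[symmetric]
    by (subst tele, simp)+ (simp add: algebra_simps)
qed

lemma gen_add: "gen (\<lambda>s. f s + g s) s = gen f s + gen g s"
  by (simp add: gen_def sum.distrib[symmetric] algebra_simps)

lemma gen_cmult: "gen (\<lambda>s. a * f s) s = a * gen f s"
  by (simp add: gen_def sum_distrib_left algebra_simps)

text \<open>Unlike in \<open>A1\<close>, the range stops before \<open>b\<close>: jobs sent to full
  servers are blocked and leave the state unchanged.\<close>

definition busy_arrival :: "lb_state \<Rightarrow> real" where
  "busy_arrival s = (\<Sum>j\<in>{1..<b}. \<Sum>m\<in>{1,2}. P s j m)"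

lemma busy_arrival_bounds:
  assumes s: "s \<in> S"
  shows "0 \<le> busy_arrival s" "busy_arrival s \<le> A1 b P s" "P s 0 1 + busy_arrival s \<le> 1"
proof -
  note nn = policy_nonneg[OF s]
  show "0 \<le> busy_arrival s" unfolding busy_arrival_def by (intro sum_nonneg nn)
  show le: "busy_arrival s \<le> A1 b P s"
    unfolding busy_arrival_def A1_def by (intro sum_mono2 sum_nonneg nn) auto
  have "{0..b} = insert 0 {1..b}" by auto
  then have "P s 0 1 + P s 0 2 + A1 b P s = 1"
    using policy_sum[OF s] by (simp add: A1_def)
  then show "P s 0 1 + busy_arrival s \<le> 1" using le nn[of 0 2] by simp
qed

text \<open>Each of the levels 2 to b is at most level 2. Many waiting jobs thus force many servers
  whose departures shorten a queue.\<close>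

lemma waiting_le:
  assumes s: "s \<in> S"
  shows "jobs b s - s 1 1 - s 1 2 \<le> real b * (s 2 1 + s 2 2)"
proof -
  have "jobs b s = s 1 1 + s 1 2 + (\<Sum>i\<in>{2..b}. s i 1 + s i 2)"
    unfolding jobs_def using b_pos
    by (subst sum.atLeast_Suc_atMost) (auto simp: numeral_2_eq_2)
  moreover have "(\<Sum>i\<in>{2..b}. s i 1 + s i 2) \<le> real (card {2..b}) * (s 2 1 + s 2 2)"
    by (intro sum_bounded_above add_mono state_space_antimono[OF N_pos s]) auto
  moreover have "\<dots> \<le> real b * (s 2 1 + s 2 2)"
    using state_space_nonneg[OF N_pos s] by (intro mult_right_mono) auto
  ultimately show ?thesis by simp
qed

end

section \<open>Constants and coordinates of the heavy-traffic regime\<close>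

text \<open>\<open>L56\<close> and \<open>mu1_le\<close> are the form in which the lower bound on ln
  N enters, and \<open>A1_le\<close> is the defining property of the policy class.\<close>

locale coxian_heavy = coxian_lb +
  fixes n L wl K :: real
  assumes n: "n = sqrt (real N)" and L: "L = ln (real N)"
    and lam: "0 \<le> lam" "lam \<le> 1" and mu1: "1 \<le> mu1" and mu2: "0 < mu2"
    and p: "0 \<le> p" "p < 1" and unit_mean: "1 / mu1 + p / mu2 = 1"
    and L56: "56 \<le> L" and mu1_le: "mu1 \<le> L"
    and wl: "wl = min ((1 - p) * mu1) mu2" and K: "K = (1 + mu1 + mu2) / wl"
    and A1_le: "\<And>s. s \<in> S \<Longrightarrow> s 1 1 + s 1 2 \<le> lam + K * L / n \<Longrightarrow> A1 b P s \<le> 1 / n"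
begin

lemma n_eq_exp: "n = exp (L / 2)"
  using N_pos by (simp add: n L flip: ln_sqrt)

lemma N_eq: "real N = n\<^sup>2"
  by (simp add: n)

lemma n_ge: "29 \<le> n"
  using exp_ge_add_one_self[of "L / 2"] L56 n_eq_exp by linarith

lemma wl_pos: "0 < wl"
  using mu1 mu2 p by (simp add: wl)

lemma wl_le: "wl \<le> mu2" "wl \<le> mu1" "wl \<le> (1 - p) * mu1"
proof -
  have "(1 - p) * mu1 \<le> 1 * mu1" using mu1 p by (intro mult_right_mono) auto
  then show "wl \<le> mu2" "wl \<le> mu1" "wl \<le> (1 - p) * mu1" by (auto simp: wl)
qed

text \<open>Two rates above 2 would make the mean service time smaller than 1.\<close>

lemma wl_le_2: "wl \<le> 2"
proof (rule ccontr)
  assume "\<not> wl \<le> 2"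
  then have "2 < mu1" "2 < mu2" using wl_le by auto
  then have "1 / mu1 < 1 / 2" "p / mu2 \<le> 1 / 2"
    using p by (auto simp: field_simps)
  then show False using unit_mean by simp
qed

lemma K_ge: "5 / 2 \<le> K"
proof -
  \<comment> \<open>Split as wl + wl + wl/2, bounded by mu1, mu2 and 1 respectively.\<close>
  have "5 / 2 * wl \<le> 1 + mu1 + mu2" using wl_le wl_le_2 by simp
  then show ?thesis using wl_pos by (simp add: K pos_le_divide_eq)
qed

text \<open>A deviation of size \<open>h\<close> in either phase is thus pulled back at rate at
  least (1 + mu1 + mu2) L / n, enough to beat the second-order terms of the exponentials.\<close>

lemma mu_K_ge: "1 + mu1 + mu2 \<le> mu1 * K" "1 + mu1 + mu2 \<le> mu2 * K"
proof -
  have "wl * K = 1 + mu1 + mu2" using wl_pos by (simp add: K)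
  then show "1 + mu1 + mu2 \<le> mu1 * K" "1 + mu1 + mu2 \<le> mu2 * K"
    using wl_le K_ge mult_right_mono[of wl _ K] by fastforce+
qed

text \<open>The margin above \<open>lam\<close> up to which the policy class controls
  \<open>A1\<close>.\<close>

definition h where "h = K * L / n"

lemma h_pos: "0 < h"
  using K_ge L56 n_ge by (simp add: h_def)

text \<open>In place of \<open>e2 = e1 + z / p\<close> the Lyapunov function uses \<open>e1 + c z\<close>: for very small p the
  jumps of e2, of size 1 / (p N), are too large for the exponential rate 2 n, so the slope is
  capped at n / 2.\<close>

definition c where "c = (if p * n \<le> 2 then n / 2 else 1 / p)"

lemma c_bounds: "1 \<le> c" "c \<le> n / 2" "p * c \<le> 1" and c_cases: "c = n / 2 \<or> p * c = 1"
proof -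
  have "0 < p" if "2 < p * n"
    using that p by (cases "p = 0") auto
  then show "1 \<le> c" "c \<le> n / 2" "p * c \<le> 1" "c = n / 2 \<or> p * c = 1"
    using n_ge p by (auto simp: c_def field_simps)
qed

definition r where "r s = jobs b s - s 1 1 - s 1 2"
definition y where "y s = s 1 1 - lam / mu1"
definition z where "z s = s 1 2 - p * lam / mu2"

text \<open>The shifts h / 4 and 3 c h / 5 leave a gap of at least 3 h / 20 between the exponents in
  each comparison made in \<open>drift\<close> below, and \<open>exp (2 n (3 h / 20)) \<ge> N powr (3 / 4)\<close> beats the
  largest possible growth rate, of order L sqrt N (lemma \<open>dominated\<close>).\<close>

definition f1 where "f1 s = exp (2 * n * r s)"
definition f2 where "f2 s = exp (2 * n * (r s + y s - h / 4))"
definition f3 where "f3 s = exp (2 * n * (r s + y s + c * z s - 3 / 5 * c * h))"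

lemma f_pos: "0 < f1 s" "0 < f2 s" "0 < f3 s"
  by (auto simp: f1_def f2_def f3_def)

section \<open>Drift of the three exponentials\<close>

abbreviation "t \<equiv> 2 / n"

lemma t_eq: "t = 2 * n / real N"
  using n_ge by (simp add: N_eq power2_eq_square)

lemma exp_t: "exp t - 1 \<le> t + t\<^sup>2" "t - t\<^sup>2 / 2 \<le> 1 - exp (- t)"
  using exp_minus_one_le_quadratic[of t] one_minus_exp_minus_ge[of t] n_ge by auto

text \<open>Since N t = 2 n and N t^2 = 4, the second-order error of a unit jump is only a
  constant.\<close>

lemma N_exp_t: "real N * (exp t - 1) \<le> 2 * n + 4" "2 * n - 2 \<le> real N * (1 - exp (- t))"
  and N_exp_t_nonneg: "0 \<le> real N * (exp t - 1)" "0 \<le> real N * (1 - exp (- t))"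
proof -
  have "n\<^sup>2 * (exp t - 1) \<le> n\<^sup>2 * (t + t\<^sup>2)" "n\<^sup>2 * (t - t\<^sup>2 / 2) \<le> n\<^sup>2 * (1 - exp (- t))"
    using exp_t by (auto intro!: mult_left_mono)
  moreover have "n\<^sup>2 * (t + t\<^sup>2) = 2 * n + 4" "n\<^sup>2 * (t - t\<^sup>2 / 2) = 2 * n - 2"
    using n_ge by (auto simp: power2_eq_square field_simps)
  ultimately show "real N * (exp t - 1) \<le> 2 * n + 4" "2 * n - 2 \<le> real N * (1 - exp (- t))"
    by (auto simp: N_eq)
  show "0 \<le> real N * (exp t - 1)" "0 \<le> real N * (1 - exp (- t))"
    using n_ge by auto
qed

text \<open>\<open>r\<close> changes only when a busy server accepts a job or a server with a queue
  completes one; every other event cancels in the exponent.\<close>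

lemma gen_f1:
  assumes s: "s \<in> S"
  shows "gen f1 s = f1 s * (lam * busy_arrival s * (real N * (exp t - 1))
    - ((1 - p) * mu1 * s 2 1 + mu2 * s 2 2) * (real N * (1 - exp (- t))))"
proof -
  have "f1 = expf (2 * n) 1 (-1) (-1)"
    by (auto simp: fun_eq_iff f1_def expf_def r_def)
  then show ?thesis
    by (simp only: gen_expf[OF s t_eq] busy_arrival_def[symmetric]) (simp add: algebra_simps)
qed

text \<open>Up to a constant, \<open>r + y\<close> counts the jobs that have not finished phase 1.
  Accepted arrivals add one, phase-1 completions remove one whatever follows, and phase-2
  completions leave it alone.\<close>

lemma gen_f2:
  assumes s: "s \<in> S"
  shows "gen f2 s = f2 s * (lam * (P s 0 1 + busy_arrival s) * (real N * (exp t - 1))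
    - mu1 * s 1 1 * (real N * (1 - exp (- t))))"
proof -
  have "f2 = (\<lambda>s. exp (- 2 * n * (lam / mu1 + h / 4)) * expf (2 * n) 1 0 (-1) s)"
    by (auto simp: fun_eq_iff f2_def expf_def r_def y_def exp_add[symmetric] algebra_simps)
  then show ?thesis
    by (simp only: gen_cmult gen_expf[OF s t_eq] busy_arrival_def[symmetric]) (simp add: algebra_simps)
qed

text \<open>Here a job has weight 1 until it finishes phase 1 and weight \<open>c\<close> during
  phase 2. Entering phase 2 therefore adds \<open>c - 1\<close>, and leaving it removes
  \<open>c\<close>.\<close>

lemma gen_f3:
  assumes s: "s \<in> S"
  shows "gen f3 s = f3 s * (lam * (P s 0 1 + busy_arrival s) * (real N * (exp t - 1))
    + mu1 * p * s 1 1 * (real N * (exp (t * (c - 1)) - 1))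
    - mu1 * (1 - p) * s 1 1 * (real N * (1 - exp (- t)))
    - mu2 * s 1 2 * (real N * (1 - exp (- (t * c)))))"
proof -
  have "f3 = (\<lambda>s. exp (- 2 * n * (lam / mu1 + c * p * lam / mu2 + 3 / 5 * c * h))
      * expf (2 * n) 1 0 (c - 1) s)"
    by (auto simp: fun_eq_iff f3_def expf_def r_def y_def z_def exp_add[symmetric] algebra_simps)
  then show ?thesis
    by (simp only: gen_cmult gen_expf[OF s t_eq] busy_arrival_def[symmetric]) (simp add: algebra_simps)
qed

lemma state_bounds:
  assumes s: "s \<in> S"
  shows "0 \<le> s i m" "s 1 1 \<le> 1"
  using state_space_nonneg[OF N_pos s] s by (auto simp: state_space_def)

lemma arrival_prob:
  assumes s: "s \<in> S"
  shows "0 \<le> lam * (P s 0 1 + busy_arrival s)" "lam * (P s 0 1 + busy_arrival s) \<le> lam"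
    "0 \<le> lam * busy_arrival s" "lam * busy_arrival s \<le> A1 b P s" "lam * busy_arrival s \<le> 1"
proof -
  note ba = busy_arrival_bounds[OF s] policy_nonneg[OF s, of 0 1]
  show "0 \<le> lam * (P s 0 1 + busy_arrival s)" "0 \<le> lam * busy_arrival s"
    using ba lam by auto
  show "lam * (P s 0 1 + busy_arrival s) \<le> lam"
    using mult_left_mono[OF ba(3) lam(1)] by simp
  have "lam * busy_arrival s \<le> 1 * busy_arrival s"
    using ba lam by (intro mult_right_mono)
  then show "lam * busy_arrival s \<le> A1 b P s" "lam * busy_arrival s \<le> 1"
    using ba by auto
qed

lemma gen_f1_le:
  assumes s: "s \<in> S"
  shows "gen f1 s \<le> f1 s * (4 * n)"
proof -
  have "lam * busy_arrival s * (real N * (exp t - 1)) \<le> 1 * (real N * (exp t - 1))"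
    using arrival_prob[OF s] N_exp_t_nonneg by (intro mult_right_mono) auto
  moreover have "0 \<le> ((1 - p) * mu1 * s 2 1 + mu2 * s 2 2) * (real N * (1 - exp (- t)))"
    using state_bounds[OF s] p mu1 mu2 n_ge by (intro mult_nonneg_nonneg add_nonneg_nonneg) auto
  ultimately show ?thesis
    unfolding gen_f1[OF s] using N_exp_t n_ge by (intro mult_left_mono) (auto simp: f1_def)
qed

text \<open>With \<open>A1\<close> at most 1/n, arrivals contribute at most 6. The threshold on
  \<open>r\<close> is chosen so that, by \<open>waiting_le\<close>, departures from servers with a
  queue contribute at least \<open>L\<close>, which is at least 56.\<close>

lemma gen_f1_neg:
  assumes s: "s \<in> S" and A: "A1 b P s \<le> 1 / n" and r: "real b * L / (n * wl) \<le> r s"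
  shows "gen f1 s \<le> f1 s * (- 4)"
proof -
  let ?D = "(1 - p) * mu1 * s 2 1 + mu2 * s 2 2"
  have "lam * busy_arrival s * (real N * (exp t - 1)) \<le> 1 / n * (2 * n + 4)"
    using arrival_prob[OF s] A N_exp_t N_exp_t_nonneg n_ge by (intro mult_mono) auto
  also have "\<dots> \<le> 6" using n_ge by (simp add: field_simps)
  finally have 1: "lam * busy_arrival s * (real N * (exp t - 1)) \<le> 6" .
  have "real b * L / (n * wl) \<le> real b * (s 2 1 + s 2 2)"
    using r waiting_le[OF s] by (simp add: r_def)
  then have "real b * (L / (n * wl)) \<le> real b * (s 2 1 + s 2 2)" by simp
  then have "L / (n * wl) \<le> s 2 1 + s 2 2"
    using b_pos by (subst (asm) mult_le_cancel_left_pos) auto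
  then have "L \<le> n * (wl * (s 2 1 + s 2 2))"
    using n_ge wl_pos by (simp add: pos_divide_le_eq mult_ac)
  also have "\<dots> \<le> n * ?D"
    unfolding distrib_left[of wl] using wl_le state_bounds[OF s] n_ge
    by (intro mult_left_mono add_mono mult_right_mono) auto
  finally have D: "L \<le> n * ?D" .
  have D0: "0 \<le> ?D"
    using state_bounds[OF s] p mu1 mu2 by (intro add_nonneg_nonneg mult_nonneg_nonneg) auto
  have "n * ?D \<le> ?D * (2 * n - 2)" using D0 n_ge
    by (subst mult.commute, intro mult_left_mono) auto
  also have "\<dots> \<le> ?D * (real N * (1 - exp (- t)))"
    using D0 N_exp_t by (intro mult_left_mono)
  finally have "L \<le> ?D * (real N * (1 - exp (- t)))" using D by simp
  then show ?thesis
    unfolding gen_f1[OF s] using 1 L56 by (intro mult_left_mono) (auto simp: f1_def)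
qed

lemma gen_f2_le:
  assumes s: "s \<in> S"
  shows "gen f2 s \<le> f2 s * (4 * n)"
proof -
  have "lam * (P s 0 1 + busy_arrival s) * (real N * (exp t - 1)) \<le> 1 * (real N * (exp t - 1))"
    using arrival_prob[OF s] lam N_exp_t_nonneg by (intro mult_right_mono) auto
  moreover have "0 \<le> mu1 * s 1 1 * (real N * (1 - exp (- t)))"
    using state_bounds[OF s] mu1 n_ge by (intro mult_nonneg_nonneg) auto
  ultimately show ?thesis
    unfolding gen_f2[OF s] using N_exp_t n_ge by (intro mult_left_mono) (auto simp: f2_def)
qed

text \<open>The leading terms of size 2 n lam cancel. The excess mu1 h / 10 in the phase-1
  completion rate then contributes at least 11, against second-order costs and target of at most 6 +
  4.\<close>

lemma gen_f2_neg:
  assumes s: "s \<in> S" and y: "h / 10 \<le> y s"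
  shows "gen f2 s \<le> f2 s * (- 4)"
proof -
  have "lam * (P s 0 1 + busy_arrival s) * (real N * (exp t - 1)) \<le> lam * (2 * n + 4)"
    using arrival_prob[OF s] lam N_exp_t N_exp_t_nonneg by (intro mult_mono) auto
  moreover have "mu1 * s 1 1 * (2 * n - 2) \<le> mu1 * s 1 1 * (real N * (1 - exp (- t)))"
    using state_bounds[OF s] mu1 N_exp_t by (intro mult_left_mono) auto
  moreover have "lam * (2 * n + 4) + 4 \<le> mu1 * s 1 1 * (2 * n - 2)"
  proof -
    have "mu1 * (h / 10) \<le> mu1 * y s" using y mu1 by (intro mult_left_mono) auto
    then have 1: "lam + mu1 * h / 10 \<le> mu1 * s 1 1"
      using mu1 by (simp add: y_def right_diff_distrib)
    have "2 * 56 \<le> (mu1 * K) * L" using mu_K_ge mu1 mu2 L56 by (intro mult_mono) auto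
    then have 2: "112 / n \<le> mu1 * h" using n_ge by (simp add: h_def divide_right_mono mult.assoc)
    have "n * 1 \<le> 2 * n - 2" using n_ge by simp
    then have "112 / n / 10 * n \<le> mu1 * h / 10 * (2 * n - 2)"
      using 2 n_ge h_pos mu1 by (intro mult_mono) auto
    then have "11 \<le> mu1 * h / 10 * (2 * n - 2)" using n_ge by simp
    moreover have "(lam + mu1 * h / 10) * (2 * n - 2) \<le> mu1 * s 1 1 * (2 * n - 2)"
      using 1 n_ge by (intro mult_right_mono) auto
    moreover have "lam * (2 * n + 4) + 4 \<le> lam * (2 * n - 2) + 11"
      using lam by (simp add: algebra_simps)
    ultimately show ?thesis unfolding distrib_right by linarith
  qed
  ultimately show ?thesis
    unfolding gen_f2[OF s] by (intro mult_left_mono) (auto simp: f2_def)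
qed

text \<open>The cap on \<open>c\<close> keeps the jump t (c - 1) at most 1, where the quadratic
  upper bound for the exponential is valid.\<close>

lemma N_exp_c:
  "real N * (exp (t * (c - 1)) - 1) \<le> 2 * n * (c - 1) + 4 * (c - 1)\<^sup>2"
  "2 * n * c - 2 * c\<^sup>2 \<le> real N * (1 - exp (- (t * c)))"
proof -
  let ?u = "t * (c - 1)"
  have "0 \<le> ?u" "?u \<le> 1" using c_bounds n_ge by (auto simp: field_simps)
  then have "real N * (exp ?u - 1) \<le> n\<^sup>2 * (?u + ?u\<^sup>2)"
    unfolding N_eq by (intro mult_left_mono exp_minus_one_le_quadratic) auto
  also have "\<dots> = 2 * n * (c - 1) + 4 * (c - 1)\<^sup>2"
    using n_ge by (simp add: power2_eq_square field_simps)
  finally show "real N * (exp ?u - 1) \<le> \<dots>" .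
  have "n\<^sup>2 * (t * c - (t * c)\<^sup>2 / 2) \<le> real N * (1 - exp (- (t * c)))"
    unfolding N_eq using c_bounds n_ge by (intro mult_left_mono one_minus_exp_minus_ge) auto
  moreover have "n\<^sup>2 * (t * c - (t * c)\<^sup>2 / 2) = 2 * n * c - 2 * c\<^sup>2"
    using n_ge by (simp add: power2_eq_square field_simps)
  ultimately show "2 * n * c - 2 * c\<^sup>2 \<le> real N * (1 - exp (- (t * c)))" by simp
qed

text \<open>Phase changes dominate: the cap on \<open>c\<close> makes the quadratic term comparable
  to the linear one, p c is at most 1, and mu1 is at most \<open>L\<close>. The \<open>- 1\<close>
  leaves room for the extra \<open>f3 s\<close> in \<open>drift\<close>.\<close>

lemma gen_f3_le:
  assumes s: "s \<in> S"
  shows "gen f3 s \<le> f3 s * (8 * n * L - 1)"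
proof -
  have 1: "lam * (P s 0 1 + busy_arrival s) * (real N * (exp t - 1)) \<le> 2 * n + 4"
  proof -
    have "lam * (P s 0 1 + busy_arrival s) * (real N * (exp t - 1)) \<le> 1 * (2 * n + 4)"
      using arrival_prob[OF s] lam N_exp_t N_exp_t_nonneg by (intro mult_mono) auto
    then show ?thesis by simp
  qed
  have "(c - 1) * (c - 1) \<le> n / 2 * (c - 1)" using c_bounds by (intro mult_right_mono) auto
  then have "real N * (exp (t * (c - 1)) - 1) \<le> 4 * n * (c - 1)"
    using N_exp_c(1) by (simp add: power2_eq_square algebra_simps)
  also have "\<dots> \<le> 4 * n * c" using n_ge by simp
  finally have "mu1 * p * s 1 1 * (real N * (exp (t * (c - 1)) - 1)) \<le> mu1 * p * s 1 1 * (4 * n * c)"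
    using state_bounds[OF s] mu1 p by (intro mult_left_mono) auto
  also have "\<dots> = 4 * n * (mu1 * ((p * c) * s 1 1))" by simp
  also have "\<dots> \<le> 4 * n * (L * (1 * 1))"
    using state_bounds[OF s] mu1 p c_bounds n_ge L56 mu1_le
    by (intro mult_left_mono mult_mono mult_nonneg_nonneg) auto
  finally have 2: "mu1 * p * s 1 1 * (real N * (exp (t * (c - 1)) - 1)) \<le> 4 * n * L" by simp
  have 3: "0 \<le> mu1 * (1 - p) * s 1 1 * (real N * (1 - exp (- t)))"
    using state_bounds[OF s] mu1 p n_ge by (intro mult_nonneg_nonneg) auto
  have 4: "0 \<le> mu2 * s 1 2 * (real N * (1 - exp (- (t * c))))"
    using state_bounds[OF s] mu2 n_ge c_bounds by (intro mult_nonneg_nonneg) auto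
  have "n * 56 \<le> n * L" using n_ge L56 by (intro mult_left_mono) auto
  then have "2 * n + 4 + 4 * n * L \<le> 8 * n * L - 1" using n_ge by linarith
  then show ?thesis
    unfolding gen_f3[OF s] using 1 2 3 4 less_imp_le[OF f_pos(3)[of s]]
    by (intro mult_left_mono; linarith)
qed

text \<open>To first order the drift of the exponent is proportional to (1 - p c) (lam - mu1 s11) -
  c mu2 z, with s11 the phase-1 fraction. The first product is 0 when p c = 1; otherwise c = n / 2,
  and it is absorbed by the restoring term, which grows with \<open>c\<close>.\<close>

lemma gen_f3_neg:
  assumes s: "s \<in> S" and z: "h / 5 \<le> z s"
  shows "gen f3 s \<le> f3 s * (- 4)"
proof -
  let ?Y = "s 1 1"
  have z0: "0 \<le> z s" using z h_pos by simp
  have Z: "mu2 * s 1 2 = mu2 * z s + p * lam" using mu2 by (simp add: z_def right_diff_distrib)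
  have "lam * (P s 0 1 + busy_arrival s) * (real N * (exp t - 1)) \<le> lam * (2 * n + 4)"
    using arrival_prob[OF s] lam N_exp_t N_exp_t_nonneg by (intro mult_mono) auto
  moreover have "mu1 * p * ?Y * (real N * (exp (t * (c - 1)) - 1))
      \<le> mu1 * p * ?Y * (2 * n * (c - 1) + 4 * (c - 1)\<^sup>2)"
    using state_bounds[OF s] mu1 p by (intro mult_left_mono N_exp_c) auto
  moreover have "mu1 * (1 - p) * ?Y * (2 * n - 2) \<le> mu1 * (1 - p) * ?Y * (real N * (1 - exp (- t)))"
    using state_bounds[OF s] mu1 p by (intro mult_left_mono N_exp_t) auto
  moreover have "mu2 * s 1 2 * (2 * n * c - 2 * c\<^sup>2) \<le> mu2 * s 1 2 * (real N * (1 - exp (- (t * c))))"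
    using state_bounds[OF s] mu2 by (intro mult_left_mono N_exp_c) auto
  moreover have "lam * (2 * n + 4) + mu1 * p * ?Y * (2 * n * (c - 1) + 4 * (c - 1)\<^sup>2)
      - mu1 * (1 - p) * ?Y * (2 * n - 2) - mu2 * s 1 2 * (2 * n * c - 2 * c\<^sup>2) \<le> - 4"
  proof -
    have "lam * (2 * n + 4) + mu1 * p * ?Y * (2 * n * (c - 1) + 4 * (c - 1)\<^sup>2)
        - mu1 * (1 - p) * ?Y * (2 * n - 2) - mu2 * s 1 2 * (2 * n * c - 2 * c\<^sup>2)
      = 2 * n * ((1 - p * c) * (lam - mu1 * ?Y)) - 2 * (n * (c * (mu2 * z s)))
        + 4 * lam + 4 * (mu1 * (?Y * (p * (c - 1)\<^sup>2))) + 2 * (mu1 * ((1 - p) * ?Y))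
        + 2 * (c * (c * (mu2 * z s))) + 2 * (c * ((p * c) * lam))"
      unfolding Z by (simp add: algebra_simps power2_eq_square)
    moreover have "2 * n * ((1 - p * c) * (lam - mu1 * ?Y)) \<le> 2 * (n * (1 - p * c))"
    proof -
      have "0 \<le> mu1 * ?Y" using mu1 state_bounds[OF s] by simp
      then have "lam - mu1 * ?Y \<le> 1" using lam by linarith
      then have "2 * n * ((1 - p * c) * (lam - mu1 * ?Y)) \<le> 2 * n * ((1 - p * c) * 1)"
        using n_ge c_bounds by (intro mult_left_mono) auto
      then show ?thesis by simp
    qed
    moreover have "mu1 * (?Y * (p * (c - 1)\<^sup>2)) \<le> mu1 * c"
    proof -
      have "p * (c - 1)\<^sup>2 \<le> p * (c * c)"
        unfolding power2_eq_square using p c_bounds by (intro mult_left_mono mult_mono) auto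
      also have "\<dots> = (p * c) * c" by simp
      also have "\<dots> \<le> 1 * c" using c_bounds by (intro mult_right_mono) auto
      finally have "?Y * (p * (c - 1)\<^sup>2) \<le> 1 * (1 * c)"
        using state_bounds[OF s] p by (rule_tac mult_mono) auto
      then show ?thesis using mu1 by simp
    qed
    moreover have "mu1 * ((1 - p) * ?Y) \<le> mu1 * c"
    proof -
      have "(1 - p) * ?Y \<le> 1 * 1"
        using p state_bounds[OF s] by (rule_tac mult_mono) auto
      then show ?thesis using mu1 c_bounds by simp
    qed
    \<comment> \<open>As \<open>c\<close> is at most n / 2, the second-order loss consumes at most
      half of the restoring term.\<close>
    moreover have "2 * (c * (c * (mu2 * z s))) \<le> n * (c * (mu2 * z s))"
    proof -
      have "c * (c * (mu2 * z s)) \<le> n / 2 * (c * (mu2 * z s))"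
        using c_bounds z0 mu2 by (intro mult_right_mono) auto
      then show ?thesis by simp
    qed
    moreover have "c * ((p * c) * lam) \<le> c"
    proof -
      have "(p * c) * lam \<le> 1 * 1" using c_bounds lam p by (rule_tac mult_mono) auto
      then show ?thesis using c_bounds by simp
    qed
    moreover have "56 / 5 * c + 56 / 5 * (mu1 * c) \<le> n * (c * (mu2 * z s))"
    proof -
      have "1 + mu1 \<le> mu2 * K" using mu_K_ge mu2 by simp
      then have "(1 + mu1) * 56 \<le> mu2 * K * L"
        using L56 mu1 by (intro mult_mono) auto
      also have "\<dots> = n * (mu2 * h)" using n_ge by (simp add: h_def)
      also have "\<dots> \<le> n * (mu2 * (5 * z s))"
        using z n_ge mu2 by (intro mult_left_mono) auto
      finally have "c * (56 / 5 * (1 + mu1)) \<le> c * (n * (mu2 * z s))"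
        using c_bounds by (intro mult_left_mono) auto
      then show ?thesis by (simp add: algebra_simps)
    qed
    \<comment> \<open>26/5 is 56/5 minus 6. For \<open>mu1 * c\<close> the 6 is 4 + 2 from the
      second-order terms; for \<open>c\<close> it is 2 plus 4, the latter covering
      \<open>4 * lam\<close> because \<open>c\<close> is at least 1.\<close>
    moreover have "2 * (n * (1 - p * c)) + 4 - 26 / 5 * c - 26 / 5 * (mu1 * c) \<le> 0"
      using c_cases
    proof
      assume "c = n / 2"
      moreover have "1 * c \<le> mu1 * c" using mu1 c_bounds by (intro mult_right_mono) auto
      moreover have "n * (1 - p * c) \<le> n * 1"
        using n_ge p c_bounds by (intro mult_left_mono) auto
      ultimately show ?thesis using n_ge by linarith
    next
      assume "p * c = 1"
      then have "n * (1 - p * c) = 0" by simp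
      moreover have "1 * c \<le> mu1 * c" using mu1 c_bounds by (intro mult_right_mono) auto
      ultimately show ?thesis using c_bounds by linarith
    qed
    ultimately show ?thesis using lam c_bounds by linarith
  qed
  ultimately show ?thesis
    unfolding gen_f3[OF s] by (intro mult_left_mono) (auto simp: f3_def)
qed

section \<open>Comparing the exponentials, and the drift of their sum\<close>

text \<open>Dividing by n = exp (L/2) leaves 8 L against the square of exp (L/8), and exp (L/8)
  exceeds both L/2 and 16.\<close>

lemma eight_n_L_le: "8 * n * L \<le> exp (3 / 4 * L)"
proof -
  have q: "1 + L / 8 + (L / 8)\<^sup>2 / 2 \<le> exp (L / 8)"
    using exp_lower_Taylor_quadratic[of "L / 8"] L56 by simp
  have "L * 56 \<le> L * L" using L56 by (intro mult_left_mono) auto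
  then have "L / 2 \<le> exp (L / 8)" "16 \<le> exp (L / 8)"
    using q L56 by (simp_all only: power2_eq_square)
  then have "L / 2 * 16 \<le> exp (L / 8) * exp (L / 8)" using L56 by (intro mult_mono) auto
  then have "8 * L \<le> exp (L / 4)" by (simp add: exp_add[symmetric])
  then have "8 * L * n \<le> exp (L / 4) * n" using n_ge by (intro mult_right_mono) auto
  also have "\<dots> = exp (3 / 4 * L)" by (simp add: n_eq_exp exp_add[symmetric])
  finally show ?thesis by (simp add: mult_ac)
qed

lemma dominated:
  assumes "u + 3 / 20 * h \<le> v"
  shows "8 * n * L * exp (2 * n * u) \<le> exp (2 * n * v)"
proof -
  have "5 / 2 * L \<le> K * L" using K_ge L56 by (intro mult_right_mono) auto
  \<comment> \<open>The right-hand side is 3/10 K L.\<close>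
  then have "3 / 4 * L \<le> 2 * n * (3 / 20 * h)"
    using n_ge by (simp add: h_def)
  also have "\<dots> \<le> 2 * n * (v - u)" using assms n_ge by (intro mult_left_mono) auto
  finally have le: "3 / 4 * L \<le> 2 * n * (v - u)" .
  have "8 * n * L * exp (2 * n * u) \<le> exp (2 * n * (v - u)) * exp (2 * n * u)"
    using le eight_n_L_le by (intro mult_right_mono) (auto intro: order_trans)
  then show ?thesis by (simp add: exp_add[symmetric] algebra_simps)
qed

definition Psi where "Psi s = f1 s + f2 s + f3 s"

lemma gen_Psi: "gen Psi s = gen f1 s + gen f2 s + gen f3 s"
proof -
  have "Psi = (\<lambda>s. (f1 s + f2 s) + f3 s)" by (simp add: Psi_def fun_eq_iff)
  then show ?thesis by (simp only: gen_add)
qed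

lemma lam_split: "lam / mu1 + p * lam / mu2 = lam"
  using arg_cong[OF unit_mean, of "\<lambda>x. x * lam"] by (simp add: algebra_simps)

text \<open>In every region each exponential either has negative drift or is smaller than another
  one by the factor \<open>?M\<close>, which beats its own growth. For a busy fraction above
  \<open>lam + h\<close> the policy gives no control, but \<open>f2\<close> (\<open>high_y\<close>)
  or \<open>f3\<close> (\<open>high_z\<close>) beats \<open>f1\<close>. Below that level
  \<open>f1\<close> decreases if \<open>r\<close> is large (\<open>low\<close>), and otherwise is
  bounded by the constant on the right (\<open>small\<close>).\<close>

lemma drift:
  assumes s: "s \<in> S"
  shows "gen Psi s + Psi s \<le> 9 * n * L * exp (2 * L * (real b / wl))"
proof -
  let ?M = "8 * n * L"
  have nL: "29 * 56 \<le> n * L" using n_ge L56 by (intro mult_mono) auto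
  have "n * 56 \<le> n * L" using n_ge L56 by (intro mult_left_mono) auto
  then have M: "4 * n \<le> ?M - 1" using n_ge by linarith
  have le1: "gen f1 s + f1 s \<le> ?M * f1 s" and le2: "gen f2 s + f2 s \<le> ?M * f2 s"
    and le3: "gen f3 s + f3 s \<le> ?M * f3 s"
    using gen_f1_le[OF s] gen_f2_le[OF s] gen_f3_le[OF s] f_pos[of s]
      mult_left_mono[OF M, of "f1 s"] mult_left_mono[OF M, of "f2 s"]
    by (auto simp: algebra_simps)
  have neg2: "gen f2 s + f2 s \<le> - 3 * f2 s" if "h / 10 \<le> y s"
    using gen_f2_neg[OF s that] by simp
  have neg3: "gen f3 s + f3 s \<le> - 3 * f3 s" if "h / 5 \<le> z s"
    using gen_f3_neg[OF s that] by simp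
  have d21: "?M * f2 s \<le> f1 s" if "y s \<le> h / 10"
    unfolding f1_def f2_def using that by (intro dominated) simp
  \<comment> \<open>The bracket is negative, so the factor \<open>c\<close>, being at least 1, only
    lowers it.\<close>
  have gap: "c * (z s - 3 / 5 * h) \<le> - 2 / 5 * h" if "z s \<le> h / 5"
  proof -
    have "c * (z s - 3 / 5 * h) \<le> 1 * (z s - 3 / 5 * h)"
      using that h_pos c_bounds by (intro mult_right_mono_neg) auto
    then show ?thesis using that by simp
  qed
  have d31: "?M * f3 s \<le> f1 s" if "y s \<le> h / 10" "z s \<le> h / 5"
    unfolding f1_def f3_def using that(1) gap[OF that(2)] h_pos
    by (intro dominated) (simp add: algebra_simps)
  have d32: "?M * f3 s \<le> f2 s" if "z s \<le> h / 5"
    unfolding f2_def f3_def using gap[OF that] by (intro dominated) (simp add: algebra_simps)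
  have v: "s 1 1 + s 1 2 = lam + y s + z s" using lam_split by (simp add: y_def z_def)
  note pos = f_pos[of s]
  have ge1: "1 * f1 s \<le> ?M * f1 s" "1 * f2 s \<le> ?M * f2 s" "1 * f3 s \<le> ?M * f3 s"
    using pos nL by (intro mult_right_mono; simp)+
  have bound0: "0 \<le> 9 * n * L * exp (2 * L * (real b / wl))" using n_ge L56 by simp
  consider (high_y) "h < y s + z s" "2 / 5 * h \<le> y s"
    | (high_z) "h < y s + z s" "y s < 2 / 5 * h"
    | (low) "y s + z s \<le> h" "real b * L / (n * wl) \<le> r s"
    | (small) "y s + z s \<le> h" "r s < real b * L / (n * wl)"
    by linarith
  then show ?thesis
  proof cases
    case high_y
    have "?M * f1 s \<le> f2 s"
      unfolding f1_def f2_def using high_y by (intro dominated) simp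
    moreover have "gen f2 s + f2 s \<le> - 3 * f2 s" using high_y h_pos by (intro neg2) simp
    moreover have "gen f3 s + f3 s \<le> f2 s" using neg3 d32 le3 pos by (cases "h / 5 \<le> z s") auto
    ultimately show ?thesis unfolding gen_Psi Psi_def using le1 bound0 pos by linarith
  next
    case high_z
    have z: "3 / 5 * h \<le> z s" using high_z by simp
    have "0 \<le> (c - 1) * (z s - 3 / 5 * h)" using z c_bounds by simp
    then have "z s - 3 / 5 * h \<le> c * z s - 3 / 5 * c * h" by (simp add: left_diff_distrib right_diff_distrib)
    then have "?M * f1 s \<le> f3 s"
      unfolding f1_def f3_def using high_z h_pos by (intro dominated) linarith
    moreover have "gen f3 s + f3 s \<le> - 3 * f3 s" using z h_pos by (intro neg3) simp
    moreover have "gen f2 s + f2 s \<le> f1 s" using neg2 d21 le2 pos by (cases "h / 10 \<le> y s") auto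
    ultimately show ?thesis unfolding gen_Psi Psi_def using le1 bound0 pos ge1 by linarith
  next
    case low
    have "A1 b P s \<le> 1 / n" using low v by (intro A1_le[OF s]) (simp add: h_def)
    then have "gen f1 s + f1 s \<le> - 3 * f1 s" using gen_f1_neg[OF s _ low(2)] by simp
    moreover have "gen f2 s + f2 s + (gen f3 s + f3 s) \<le> 2 * f1 s"
      using neg2 d21 le2 neg3 d31 d32 le3 pos
      by (cases "h / 10 \<le> y s"; cases "h / 5 \<le> z s") force+
    ultimately show ?thesis unfolding gen_Psi Psi_def using bound0 pos by linarith
  next
    case small
    have "gen f2 s + f2 s + (gen f3 s + f3 s) \<le> 2 * f1 s"
      using neg2 d21 le2 neg3 d31 d32 le3 pos
      by (cases "h / 10 \<le> y s"; cases "h / 5 \<le> z s") force+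
    moreover have "2 * f1 s \<le> n * L * f1 s" using pos nL by (intro mult_right_mono) auto
    ultimately have "gen Psi s + Psi s \<le> 9 * n * L * f1 s"
      using le1 by (simp add: gen_Psi Psi_def)
    also have "\<dots> \<le> 9 * n * L * exp (2 * L * (real b / wl))"
    proof -
      have "2 * n * r s \<le> 2 * n * (real b * L / (n * wl))"
        using small n_ge by (intro mult_left_mono) auto
      also have "\<dots> = 2 * L * (real b / wl)" using n_ge by simp
      finally show ?thesis unfolding f1_def using n_ge L56 by (intro mult_left_mono) auto
    qed
    finally show ?thesis .
  qed
qed

section \<open>From the drift inequality to the mean excess\<close>

text \<open>If z is at most 3 h / 5, compare with \<open>f2\<close>, at a cost of 3/5 + 1/4 = 17/20
  of \<open>h\<close>; otherwise \<open>f3\<close> is enough, because \<open>c\<close> is at least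
  1.\<close>

lemma exp_jobs_le: "exp (2 * n * (jobs b s - lam)) \<le> exp (17 / 10 * K * L) * Psi s"
proof -
  have e: "17 / 10 * K * L = 2 * n * (17 / 20 * h)" using n_ge by (simp add: h_def)
  have j: "jobs b s - lam = r s + y s + z s" using lam_split by (simp add: r_def y_def z_def)
  have "2 * n * (jobs b s - lam) \<le> 17 / 10 * K * L + 2 * n * (r s + y s - h / 4) \<or>
      2 * n * (jobs b s - lam) \<le> 17 / 10 * K * L + 2 * n * (r s + y s + c * z s - 3 / 5 * c * h)"
    unfolding e j distrib_left[symmetric]
  proof (cases "z s \<le> 3 / 5 * h")
    case True
    then show "2 * n * (r s + y s + z s) \<le> 2 * n * (17 / 20 * h + (r s + y s - h / 4)) \<or>
      2 * n * (r s + y s + z s) \<le> 2 * n * (17 / 20 * h + (r s + y s + c * z s - 3 / 5 * c * h))"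
      using n_ge by (intro disjI1 mult_left_mono) auto
  next
    case False
    then have "0 \<le> (c - 1) * (z s - 3 / 5 * h)" using c_bounds by simp
    then have "z s - 3 / 5 * h \<le> c * z s - 3 / 5 * c * h" by (simp add: left_diff_distrib right_diff_distrib)
    then show "2 * n * (r s + y s + z s) \<le> 2 * n * (17 / 20 * h + (r s + y s - h / 4)) \<or>
      2 * n * (r s + y s + z s) \<le> 2 * n * (17 / 20 * h + (r s + y s + c * z s - 3 / 5 * c * h))"
      using n_ge h_pos by (intro disjI2 mult_left_mono; linarith)
  qed
  then have "exp (2 * n * (jobs b s - lam)) \<le> exp (17 / 10 * K * L) * f2 s \<or>
      exp (2 * n * (jobs b s - lam)) \<le> exp (17 / 10 * K * L) * f3 s"
    by (simp add: f2_def f3_def exp_add[symmetric])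
  moreover have "exp (17 / 10 * K * L) * f2 s \<le> exp (17 / 10 * K * L) * Psi s"
    "exp (17 / 10 * K * L) * f3 s \<le> exp (17 / 10 * K * L) * Psi s"
    using f_pos[of s] by (auto simp: Psi_def)
  ultimately show ?thesis by linarith
qed

lemma expected_excess:
  assumes st: "stationary_dist N b lam mu1 mu2 p P \<pi>"
    and k: "K + real b / wl + 2 \<le> k"
  shows "(\<Sum>s\<in>S. \<pi> s * max (jobs b s - lam - k * L / n) 0) \<le> 9 / 2 * L * exp (- 4 * L)"
proof -
  have \<pi>: "0 \<le> \<pi> s" if "s \<in> S" for s using st that by (simp add: stationary_dist_def)
  have \<pi>1: "(\<Sum>s\<in>S. \<pi> s) = 1" using st by (simp add: stationary_dist_def)
  let ?C = "9 * n * L * exp (2 * L * (real b / wl))"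
  have "(\<Sum>s\<in>S. \<pi> s * gen Psi s) = 0"
    unfolding gen_def using st by (intro sum_stationary_generator) (simp add: stationary_dist_def)
  then have "(\<Sum>s\<in>S. \<pi> s * Psi s) = (\<Sum>s\<in>S. \<pi> s * (gen Psi s + Psi s))"
    by (simp add: distrib_left sum.distrib)
  also have "\<dots> \<le> (\<Sum>s\<in>S. \<pi> s * ?C)"
    by (intro sum_mono mult_left_mono drift \<pi>)
  also have "\<dots> = ?C" using \<pi>1 by (simp add: sum_distrib_right[symmetric])
  finally have E: "(\<Sum>s\<in>S. \<pi> s * Psi s) \<le> ?C" .
  let ?D = "exp (17 / 10 * K * L - 2 * k * L) / (2 * n)"
  have "max (jobs b s - lam - k * L / n) 0 \<le> ?D * Psi s" for s
  proof -
    let ?u = "jobs b s - lam - k * L / n"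
    \<comment> \<open>The exponential is positive and exceeds its argument.\<close>
    have "2 * n * max ?u 0 \<le> exp (2 * n * ?u)"
      using exp_ge_add_one_self[of "2 * n * ?u"] n_ge by (auto simp: max_def simp del: exp_ge_add_one_self)
    also have "2 * n * ?u = 2 * n * (jobs b s - lam) - 2 * k * L"
      using n_ge by (simp add: algebra_simps)
    also have "exp \<dots> = exp (2 * n * (jobs b s - lam)) * exp (- 2 * k * L)"
      by (simp add: exp_add[symmetric])
    also have "\<dots> \<le> exp (17 / 10 * K * L) * Psi s * exp (- 2 * k * L)"
      using exp_jobs_le by (intro mult_right_mono) auto
    also have "\<dots> = exp (17 / 10 * K * L - 2 * k * L) * Psi s"
      by (simp add: exp_add[symmetric] mult.commute mult.left_commute)
    finally have "2 * n * max ?u 0 / (2 * n) \<le> exp (17 / 10 * K * L - 2 * k * L) * Psi s / (2 * n)"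
      using n_ge by (intro divide_right_mono) auto
    then show ?thesis using n_ge by simp
  qed
  then have "(\<Sum>s\<in>S. \<pi> s * max (jobs b s - lam - k * L / n) 0) \<le> (\<Sum>s\<in>S. \<pi> s * (?D * Psi s))"
    by (intro sum_mono mult_left_mono \<pi>)
  also have "\<dots> = ?D * (\<Sum>s\<in>S. \<pi> s * Psi s)"
    by (subst sum_distrib_left, intro sum.cong refl, simp)
  also have "\<dots> \<le> ?D * ?C" using E n_ge by (intro mult_left_mono) auto
  also have "\<dots> = 9 / 2 * L * exp (17 / 10 * K * L - 2 * k * L + 2 * L * (real b / wl))"
    using n_ge by (simp add: exp_add)
  also have "\<dots> \<le> 9 / 2 * L * exp (- 4 * L)"
  proof -
    \<comment> \<open>Twice this lower bound on \<open>k\<close> cancels the b / wl term, outweighs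
      17/10 K, and leaves the decay -4 L.\<close>
    have "L * (K + real b / wl + 2) \<le> L * k" using k L56 by (intro mult_left_mono) auto
    moreover have "0 \<le> L * K" using L56 K_ge by simp
    ultimately have "17 / 10 * K * L - 2 * k * L + 2 * L * (real b / wl) \<le> - 4 * L"
      by (simp add: algebra_simps)
    then show ?thesis using L56 by simp
  qed
  finally show ?thesis .
qed

end

section \<open>Checking the constants of the theorem\<close>

theorem theorem1:
  fixes N b :: nat and \<alpha> lam mu1 mu2 p wu wl mumax k :: real
    and P :: "lb_state \<Rightarrow> nat \<Rightarrow> nat \<Rightarrow> real" and \<pi> :: "lb_state \<Rightarrow> real"
  assumes "0 < \<alpha>" "\<alpha> < 0.5"
    and "lam = 1 - real N powr (- \<alpha>)"
    and "0 < mu1" "0 < mu2" "0 \<le> p" "p < 1" "1 / mu1 + p / mu2 = 1"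
    and "1 \<le> b"
    and "in_Pi N b lam mu1 mu2 p P"
    and "stationary_dist N b lam mu1 mu2 p P \<pi>"
    and "wu = max ((1 - p) * mu1) mu2" "wl = min ((1 - p) * mu1) mu2"
    and "mumax = max mu1 mu2"
    and "k = (1 + wu * real b / wl) * ((1 + mu1 + mu2) / wl + 2 * mu1)"
    and "wl * real N powr (0.5 - \<alpha>) / (1 + mu1 + mu2) \<ge> ln (real N)"
    and "ln (real N) \<ge> 3.5 / min (min (mu1 / (16 * mumax)) (mu2 / (12 * mumax))) (mu1 * mu2 / (40 * mumax))"
  shows "(\<Sum>s\<in>state_space N b. \<pi> s *
            max ((\<Sum>i\<in>{1..b}. s i 1 + s i 2) - lam - k * ln (real N) / sqrt (real N)) 0)
         \<le> 7 * mumax / (sqrt (real N) * ln (real N))"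
proof -
  define L where "L = ln (real N)"
  define n where "n = sqrt (real N)"
  define m where "m = min (min (mu1 / (16 * mumax)) (mu2 / (12 * mumax))) (mu1 * mu2 / (40 * mumax))"
  note mu = assms(4,5)
  have M: "mu1 \<le> mumax" "mu2 \<le> mumax" "0 < mumax" using mu assms(14) by auto
  have m0: "0 < m" using mu M by (simp add: m_def)
  have Lm: "3.5 \<le> L * m" using assms(17) m0 by (simp add: L_def m_def[symmetric] pos_divide_le_eq)
  have L0: "0 < L" using Lm m0 mult_nonpos_nonneg[of L m] by linarith
  have "L * m \<le> L * (mu1 / (16 * mumax))" "L * m \<le> L * (mu2 / (12 * mumax))"
    using L0 by (intro mult_left_mono; simp add: m_def)+
  then have "3.5 \<le> L * (mu1 / (16 * mumax))" "3.5 \<le> L * (mu2 / (12 * mumax))"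
    using Lm by auto
  \<comment> \<open>56 = 3.5 * 16 and 42 = 3.5 * 12.\<close>
  then have LM: "56 * mumax \<le> L * mu1" "42 * mumax \<le> L * mu2"
    using M by (auto simp: field_simps)
  have L56: "56 \<le> L"
  proof -
    have "56 * mu1 \<le> L * mu1" using LM M by linarith
    then show ?thesis using mu by simp
  qed
  have mu1_ge: "1 \<le> mu1"
  proof -
    have "1 / mu1 \<le> 1" using assms(8) divide_nonneg_pos[of p mu2] assms(6) mu by linarith
    then show ?thesis using mu by simp
  qed
  \<comment> \<open>For small mu2 this follows from the bound 42 mumax; for large mu2 phase 2 takes
    little of the unit mean, so mu1 is close to 1.\<close>
  have mu1_le: "mu1 \<le> L"
  proof (cases "mu2 \<le> 42")
    case True
    have "42 * mu1 \<le> L * mu2" using LM M by linarith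
    also have "\<dots> \<le> L * 42" using True L0 by (intro mult_left_mono) auto
    finally show ?thesis by simp
  next
    case False
    have "p / mu2 \<le> 1 / 42" using False assms(6,7) by (intro frac_le) auto
    then have "41 / 42 \<le> 1 / mu1" using assms(8) by linarith
    then have "mu1 \<le> 42 / 41" using mu by (simp add: field_simps)
    then show ?thesis using L56 by simp
  qed
  have N0: "0 < N" using L0 by (cases "N = 0") (auto simp: L_def)
  have lam: "0 \<le> lam" "lam \<le> 1"
  proof -
    have "real N powr (- \<alpha>) \<le> real N powr 0"
      using N0 assms(1) by (intro powr_mono) auto
    then show "0 \<le> lam" "lam \<le> 1" using N0 assms(3) by auto
  qed
  \<comment> \<open>a sum over an infinite state space would be 0, not 1\<close>
  have fin: "finite (state_space N b)"
    using assms(11) by (metis stationary_dist_def sum.infinite zero_neq_one)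
  define K where "K = (1 + mu1 + mu2) / wl"
  interpret coxian_heavy N b lam mu1 mu2 p P n L wl K
  proof
    show "A1 b P s \<le> 1 / n" if "s \<in> state_space N b" "s 1 1 + s 1 2 \<le> lam + K * L / n" for s
      using assms(10) that by (simp add: in_Pi_def K_def n_def L_def assms(13))
    show "valid_policy N b P" using assms(10) by (simp add: in_Pi_def)
  qed (fact N0 assms fin lam mu1_ge mu1_le L56 n_def L_def K_def)+
  have "K + real b / wl + 2 \<le> k"
  proof -
    \<comment> \<open>Expanding \<open>k\<close> gives K + 2 mu1 plus b / wl times wu (K + 2 mu1).
      The last factor is at least wl K, hence at least 1, and 2 mu1 is at least 2.\<close>
    have "1 \<le> 1 + mu1 + mu2" using mu by simp
    also have "\<dots> = wl * K" using wl_pos by (simp add: K_def)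
    also have "\<dots> \<le> wu * (K + 2 * mu1)"
      using K_ge mu assms(12,13) by (intro mult_mono) auto
    finally have "real b / wl * 1 \<le> real b / wl * (wu * (K + 2 * mu1))"
      using wl_pos by (intro mult_left_mono) auto
    moreover have "k = K + 2 * mu1 + real b / wl * (wu * (K + 2 * mu1))"
      unfolding assms(15) K_def[symmetric] by (simp add: algebra_simps)
    ultimately show ?thesis using mu1_ge by simp
  qed
  from expected_excess[OF assms(11) this]
  have "(\<Sum>s\<in>state_space N b. \<pi> s *
            max ((\<Sum>i\<in>{1..b}. s i 1 + s i 2) - lam - k * ln (real N) / sqrt (real N)) 0)
      \<le> 9 / 2 * L * exp (- 4 * L)"
    by (simp add: jobs_def n_def L_def)
  also have "\<dots> \<le> 7 * mumax / (n * L)"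
  proof -
    \<comment> \<open>The decay exp (-4 L), which is N^(-4), absorbs L^2 n; the constant 9/2 is
      below 7 mumax since mumax is at least 1.\<close>
    have "L \<le> exp L" using exp_ge_add_one_self[of L] by linarith
    moreover have "n \<le> exp L" using L56 by (simp add: n_eq_exp)
    ultimately have "L * L * n \<le> exp L * exp L * exp L" using L56 n_ge by (intro mult_mono) auto
    also have "\<dots> \<le> exp (4 * L)" using L56 by (simp add: exp_add[symmetric])
    finally have "L * L * n * exp (- 4 * L) \<le> exp (4 * L) * exp (- 4 * L)"
      by (intro mult_right_mono) auto
    then have "9 / 2 * (L * L * n * exp (- 4 * L)) \<le> 7 * mumax"
      using M mu1_ge by (simp add: exp_add[symmetric])
    then show ?thesis using L56 n_ge by (simp add: pos_le_divide_eq mult_ac)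
  qed
  finally show ?thesis by (simp add: n_def L_def)
qed

end
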